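(* For all integers $m,n\ge 2$, $$\mathrm{BSR}(m,n)\ \ge\ z_{wA}(m,n)\ \ge\ z_{wL}(m,n)\ \ge\ z_L(m,n)\ \ge\ z(m,n).$$
   Context: Notation: $[m]=\{1,\dots,m\}$. An $m\times n$ biquadratic form is a real polynomial $P(\mathbf{x},\mathbf{y})=\sum_{i,k=1}^m\sum_{j,l=1}^n a_{ijkl}x_ix_ky_jy_l$ (with $a_{ijkl}=a_{kjil}=a_{klij}$). It is SOS if $P=\sum_{p=1}^r f_p^2$ with each $f_p$ a real bilinear form in $(\mathbf{x},\mathbf{y})$; the minimum such $r$ is its SOS rank $\mathrm{SOS}(P)$. $\mathrm{BSR}(m,n)$ is the maximum SOS rank among all $m\times n$ SOS biquadratic forms. $z(m,n)$ (the Zarankiewicz number) is the maximum number of edges of an $m\times n$ bipartite graph with no $C_4$. Augmented bipartite graphs $G=(S,T,E_1\cup E_2)$, $S=[m]$, $T=[n]$. A cell is a pair $(i,j)\in[m]\times[n]$ ($i$ is its row, $j$ its column). A 1-edge is a cell; $E_1$ is a set of 1-edges, viewed as a bipartite graph $G_1$ on $S,T$. A 2-edge is an unordered pair of distinct cells, written $(i,j;k,l)$; the cells $(i,j)$ and $(k,l)$ are its two halves. It is nondegenerate if $i\ne k$ and $j\ne l$, row-degenerate if $i=k$ and $j\neq l$, column-degenerate if $i\ne k$ and $j=l$. $E_2$ is a set of 2-edges. A cell is occupied if it is in $E_1$ or is a half of some 2-edge in $E_2$; otherwise it is unoccupied. The opposite cells of a nondegenerate 2-edge $(i,j;k,l)$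 are $(i,l)$ and $(k,j)$. Two nondegenerate 2-edges of the form $(i,j;k,l)$ and $(i,l;k,j)$ are called complementary. The dependency graph $\mathcal{D}$ is the directed graph whose vertices are the nondegenerate 2-edges in $E_2$, with an arc $e\to e'$ ($e\ne e'$) if both opposite cells of $e$ are occupied and one half of $e'$ is an opposite cell of $e$. An edge's row (column) set is the set of rows (columns) of its cell (1-edge) or of its halves (2-edge). Two edges are vertex-disjoint if their row sets are disjoint and their column sets are disjoint. The opposite cells of a vertex-disjoint pair $e,f$ are the cells formed by a row of one of the two edges and a column of the other. For a 1-edge $(i,j)$ and a 2-edge $(k,l;p,q)$ they are $(i,l),(i,q),(k,j),(p,j)$. Conditions: (S) No 2-edge shares a cell with any 1-edge or with any other 2-edge. (W1) $G_1$ contains no $C_4$. (W2) $\mathcal{D}$ contains no directed cycle other than 2-cycles formed by a pair of complementary 2-edges (which are allowed). (W2') There is no nondegenerate 2-edge in $E_2$ whose two opposite cells are both 1-edges. (W3) For every vertex-disjoint pair of edges of $G$ at least one of which is a 2-edge, at least one of the opposite cells of the pair is unoccupied. $z_{wA}(m,n)$ is the maximum of $|E_1|+|E_2|$ over all $G$ satisfying (S), (W1), (W2), (W2'), (W3). $z_{wL}(m,n)$ is the maximum of $|E_1|+|E_2|$ over those such $G$ that in addition satisfy $|E_1|=z(m,n)$. $z_L(m,n)$ (the limited augmented Zarankiewicz number) is the maximum of $|E_1|+|E_2|$ over all $G$ with $|E_1|=z(m,n)$ satisfying (S), (W1), and the two original conditions: (Condition 2) no nondegenerate 2-edge in $E_2$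 has both of its opposite cells occupied; (Condition 3) there are no 2-edge $(i,j;p,q)\in E_2$ and cell $(k,l)$ with $k\notin\{i,p\}$, $l\notin\{j,q\}$ such that all of the cells $(k,l),(k,j),(k,q),(i,l),(p,l)$ are occupied. *)

theory Defs
  imports Complex_Main "Graph_Theory.Pair_Digraph"
begin

section \<open>Biquadratic forms and SOS rank\<close>

text \<open>
  Real polynomials are represented by the functions they induce, which determine them because the
  reals are infinite. The vectors \<open>x\<close> and \<open>y\<close> are functions on \<open>nat\<close>, of which only the
  values on \<open>{1..m}\<close> and \<open>{1..n}\<close>, respectively, are used.
\<close>

type_synonym form = "(nat \<Rightarrow> real) \<Rightarrow> (nat \<Rightarrow> real) \<Rightarrow> real"

definition biquadratic_form :: "nat \<Rightarrow> nat \<Rightarrow> form \<Rightarrow> bool" where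
  "biquadratic_form m n P \<longleftrightarrow>
     (\<exists>a :: nat \<Rightarrow> nat \<Rightarrow> nat \<Rightarrow> nat \<Rightarrow> real.
        (\<forall>i\<in>{1..m}. \<forall>j\<in>{1..n}. \<forall>k\<in>{1..m}. \<forall>l\<in>{1..n}.
           a i j k l = a k j i l \<and> a i j k l = a k l i j) \<and>
        (\<forall>x y. P x y =
           (\<Sum>i\<in>{1..m}. \<Sum>k\<in>{1..m}. \<Sum>j\<in>{1..n}. \<Sum>l\<in>{1..n}. a i j k l * x i * x k * y j * y l)))"

definition bilinear_form :: "nat \<Rightarrow> nat \<Rightarrow> form \<Rightarrow> bool" where
  "bilinear_form m n f \<longleftrightarrow>
     (\<exists>c :: nat \<Rightarrow> nat \<Rightarrow> real. \<forall>x y. f x y = (\<Sum>i\<in>{1..m}. \<Sum>j\<in>{1..n}. c i j * x i * y j))"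

definition sum_of_squares :: "nat \<Rightarrow> nat \<Rightarrow> nat \<Rightarrow> form \<Rightarrow> bool" where
  "sum_of_squares m n r P \<longleftrightarrow>
     (\<exists>f :: nat \<Rightarrow> form. (\<forall>p\<in>{1..r}. bilinear_form m n (f p)) \<and>
        (\<forall>x y. P x y = (\<Sum>p\<in>{1..r}. (f p x y)\<^sup>2)))"

definition is_SOS :: "nat \<Rightarrow> nat \<Rightarrow> form \<Rightarrow> bool" where
  "is_SOS m n P \<longleftrightarrow> (\<exists>r. sum_of_squares m n r P)"

definition SOS_rank :: "nat \<Rightarrow> nat \<Rightarrow> form \<Rightarrow> nat" where
  "SOS_rank m n P = (LEAST r. sum_of_squares m n r P)"

definition BSR :: "nat \<Rightarrow> nat \<Rightarrow> nat" where
  "BSR m n = Max {SOS_rank m n P | P. biquadratic_form m n P \<and> is_SOS m n P}"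


section \<open>Zarankiewicz numbers\<close>

type_synonym cell = "nat \<times> nat"

definition cells :: "nat \<Rightarrow> nat \<Rightarrow> cell set" where
  "cells m n = {1..m} \<times> {1..n}"

text \<open>
  A set of cells is the edge set of a bipartite graph with parts rows and columns. A 4-cycle of
  such a graph alternates between two distinct rows \<open>i\<close>, \<open>k\<close> and two distinct columns
  \<open>j\<close>, \<open>l\<close>.
\<close>

definition C4_free :: "cell set \<Rightarrow> bool" where
  "C4_free E \<longleftrightarrow>
     \<not> (\<exists>i j k l. i \<noteq> k \<and> j \<noteq> l \<and> (i, j) \<in> E \<and> (k, j) \<in> E \<and> (k, l) \<in> E \<and> (i, l) \<in> E)"

definition zarankiewicz :: "nat \<Rightarrow> nat \<Rightarrow> nat" where
  "zarankiewicz m n = Max {card E | E. E \<subseteq> cells m n \<and> C4_free E}"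


section \<open>Augmented bipartite graphs\<close>

text \<open>
  A 2-edge \<open>(i,j;k,l)\<close> is the two-element set \<open>{(i, j), (k, l)}\<close> of its halves.
\<close>

type_synonym edge2 = "cell set"

definition augmented_graph :: "nat \<Rightarrow> nat \<Rightarrow> cell set \<Rightarrow> edge2 set \<Rightarrow> bool" where
  "augmented_graph m n E1 E2 \<longleftrightarrow>
     E1 \<subseteq> cells m n \<and> E2 \<subseteq> {{c, d} | c d. c \<in> cells m n \<and> d \<in> cells m n \<and> c \<noteq> d}"

definition nondegenerate :: "edge2 \<Rightarrow> bool" where
  "nondegenerate e \<longleftrightarrow> (\<exists>i j k l. e = {(i, j), (k, l)} \<and> i \<noteq> k \<and> j \<noteq> l)"

definition occupied :: "cell set \<Rightarrow> edge2 set \<Rightarrow> cell set" where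
  "occupied E1 E2 = E1 \<union> \<Union>E2"

text \<open>
  Since the halves can be listed in either order, the following set contains both \<open>(i, l)\<close> and
  \<open>(k, j)\<close>.
\<close>

definition opposite_cells :: "edge2 \<Rightarrow> cell set" where
  "opposite_cells e = {(i, l) | i j k l. e = {(i, j), (k, l)} \<and> i \<noteq> k \<and> j \<noteq> l}"

definition complementary :: "edge2 \<Rightarrow> edge2 \<Rightarrow> bool" where
  "complementary e e' \<longleftrightarrow>
     (\<exists>i j k l. i \<noteq> k \<and> j \<noteq> l \<and> e = {(i, j), (k, l)} \<and> e' = {(i, l), (k, j)})"

definition dependency_graph :: "cell set \<Rightarrow> edge2 set \<Rightarrow> edge2 pair_pre_digraph" where
  "dependency_graph E1 E2 =
     \<lparr> pverts = {e \<in> E2. nondegenerate e},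
       parcs = {(e, e'). e \<in> E2 \<and> nondegenerate e \<and> e' \<in> E2 \<and> nondegenerate e' \<and> e \<noteq> e' \<and>
                  opposite_cells e \<subseteq> occupied E1 E2 \<and> e' \<inter> opposite_cells e \<noteq> {}} \<rparr>"

text \<open>
  Edges of both kinds are treated uniformly as sets of cells, the 1-edge \<open>c\<close> becoming \<open>{c}\<close>.
\<close>

definition edges :: "cell set \<Rightarrow> edge2 set \<Rightarrow> cell set set" where
  "edges E1 E2 = {{c} | c. c \<in> E1} \<union> E2"

definition row_set :: "cell set \<Rightarrow> nat set" where
  "row_set e = fst ` e"

definition col_set :: "cell set \<Rightarrow> nat set" where
  "col_set e = snd ` e"

definition vertex_disjoint :: "cell set \<Rightarrow> cell set \<Rightarrow> bool" where
  "vertex_disjoint e f \<longleftrightarrow> row_set e \<inter> row_set f = {} \<and> col_set e \<inter> col_set f = {}"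

definition pair_opposite_cells :: "cell set \<Rightarrow> cell set \<Rightarrow> cell set" where
  "pair_opposite_cells e f = row_set e \<times> col_set f \<union> row_set f \<times> col_set e"


section \<open>Admissibility conditions\<close>

definition cond_S :: "cell set \<Rightarrow> edge2 set \<Rightarrow> bool" where
  "cond_S E1 E2 \<longleftrightarrow>
     (\<forall>e\<in>E2. e \<inter> E1 = {}) \<and> (\<forall>e\<in>E2. \<forall>f\<in>E2. e \<noteq> f \<longrightarrow> e \<inter> f = {})"

definition cond_W1 :: "cell set \<Rightarrow> bool" where
  "cond_W1 E1 \<longleftrightarrow> C4_free E1"

text \<open>
  In \<^const>\<open>pre_digraph.cycle\<close> a cycle is a nonempty closed walk, given by its list of arcs,
  without repeated vertices except for the coinciding end points.
\<close>

definition cond_W2 :: "cell set \<Rightarrow> edge2 set \<Rightarrow> bool" where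
  "cond_W2 E1 E2 \<longleftrightarrow>
     (\<forall>p. pre_digraph.cycle (with_proj (dependency_graph E1 E2)) p \<longrightarrow>
        (\<exists>e e'. complementary e e' \<and> p = [(e, e'), (e', e)]))"

definition cond_W2' :: "cell set \<Rightarrow> edge2 set \<Rightarrow> bool" where
  "cond_W2' E1 E2 \<longleftrightarrow> \<not> (\<exists>e\<in>E2. nondegenerate e \<and> opposite_cells e \<subseteq> E1)"

definition cond_W3 :: "cell set \<Rightarrow> edge2 set \<Rightarrow> bool" where
  "cond_W3 E1 E2 \<longleftrightarrow>
     (\<forall>e\<in>edges E1 E2. \<forall>f\<in>edges E1 E2. (e \<in> E2 \<or> f \<in> E2) \<and> vertex_disjoint e f \<longrightarrow>
        (\<exists>c\<in>pair_opposite_cells e f. c \<notin> occupied E1 E2))"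

definition condition2 :: "cell set \<Rightarrow> edge2 set \<Rightarrow> bool" where
  "condition2 E1 E2 \<longleftrightarrow> \<not> (\<exists>e\<in>E2. nondegenerate e \<and> opposite_cells e \<subseteq> occupied E1 E2)"

definition condition3 :: "cell set \<Rightarrow> edge2 set \<Rightarrow> bool" where
  "condition3 E1 E2 \<longleftrightarrow>
     \<not> (\<exists>i j p q k l. {(i, j), (p, q)} \<in> E2 \<and> k \<notin> {i, p} \<and> l \<notin> {j, q} \<and>
          {(k, l), (k, j), (k, q), (i, l), (p, l)} \<subseteq> occupied E1 E2)"

definition weakly_admissible :: "nat \<Rightarrow> nat \<Rightarrow> cell set \<Rightarrow> edge2 set \<Rightarrow> bool" where
  "weakly_admissible m n E1 E2 \<longleftrightarrow>
     augmented_graph m n E1 E2 \<and> cond_S E1 E2 \<and> cond_W1 E1 \<and> cond_W2 E1 E2 \<and> cond_W2' E1 E2 \<and>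
     cond_W3 E1 E2"

definition z_wA :: "nat \<Rightarrow> nat \<Rightarrow> nat" where
  "z_wA m n = Max {card E1 + card E2 | E1 E2. weakly_admissible m n E1 E2}"

definition z_wL :: "nat \<Rightarrow> nat \<Rightarrow> nat" where
  "z_wL m n = Max {card E1 + card E2 | E1 E2.
     weakly_admissible m n E1 E2 \<and> card E1 = zarankiewicz m n}"

definition z_L :: "nat \<Rightarrow> nat \<Rightarrow> nat" where
  "z_L m n = Max {card E1 + card E2 | E1 E2.
     augmented_graph m n E1 E2 \<and> card E1 = zarankiewicz m n \<and>
     cond_S E1 E2 \<and> cond_W1 E1 \<and> condition2 E1 E2 \<and> condition3 E1 E2}"

end

theory Submission
  imports Defs "Graph_Theory.Digraph_Component"
begin

text \<open>
  The inequality \<open>z\<^sub>w\<^sub>A \<le> BSR\<close> is witnessed by the form whose squares are the edges, each edge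
  contributing \<open>(\<Sum>(i, j)\<in>e. x\<^sub>i y\<^sub>j)\<^sup>2\<close>. An arbitrary representation of it by \<open>r\<close> squares assigns to
  every cell a coefficient vector in \<open>\<real>\<^sup>r\<close>: a unit vector if the cell is occupied, and \<open>0\<close>
  otherwise. Comparing coefficients determines the inner products of cells in a common row or
  column, but for a rectangle only the sum of the inner products over its two diagonals.
  Well-founded induction along the dependency graph shows that the two halves of every 2-edge carry
  the same vector: the two opposite cells of a 2-edge are orthogonal, unless they form a
  complementary 2-edge, in which case the two inner products sum to 2 and hence both equal 1. It
  follows that distinct edges carry orthogonal vectors, so \<open>r\<close> is at least the number of edges.
  The other inequalities compare maxima over nested families of graphs: Condition 2 leaves the
  dependency graph without arcs, and Condition 3 gives (W3).
\<close>

section \<open>Sums of squares of bilinear forms\<close>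

definition bilin :: "nat \<Rightarrow> nat \<Rightarrow> (cell \<Rightarrow> real) \<Rightarrow> form" where
  "bilin m n c x y = (\<Sum>i\<in>{1..m}. \<Sum>j\<in>{1..n}. c (i, j) * x i * y j)"

lemma bilin_cells: "bilin m n c x y = (\<Sum>a\<in>cells m n. c a * x (fst a) * y (snd a))"
  unfolding bilin_def cells_def sum.cartesian_product by (rule sum.cong) auto

lemma finite_cells [simp]: "finite (cells m n)"
  by (simp add: cells_def)

lemma card_cells: "card (cells m n) = m * n"
  by (simp add: cells_def)

lemma bilinear_form_iff: "bilinear_form m n f \<longleftrightarrow> (\<exists>c. f = bilin m n c)"
proof
  assume "bilinear_form m n f"
  then obtain c where "\<And>x y. f x y = (\<Sum>i\<in>{1..m}. \<Sum>j\<in>{1..n}. c i j * x i * y j)"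
    unfolding bilinear_form_def by blast
  then have "f = bilin m n (\<lambda>(i, j). c i j)"
    by (simp add: fun_eq_iff bilin_def)
  then show "\<exists>c. f = bilin m n c" by blast
next
  assume "\<exists>c. f = bilin m n c"
  then obtain c where "f = bilin m n c" ..
  then show "bilinear_form m n f"
    unfolding bilinear_form_def bilin_def by (intro exI[of _ "\<lambda>i j. c (i, j)"]) simp
qed

lemma sum_of_squares_iff:
  "sum_of_squares m n r P \<longleftrightarrow> (\<exists>c. \<forall>x y. P x y = (\<Sum>p\<in>{1..r}. (bilin m n (c p) x y)\<^sup>2))"
proof
  assume "sum_of_squares m n r P"
  then obtain f where f: "\<And>p. p \<in> {1..r} \<Longrightarrow> bilinear_form m n (f p)"
    and P: "\<And>x y. P x y = (\<Sum>p\<in>{1..r}. (f p x y)\<^sup>2)"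
    unfolding sum_of_squares_def by blast
  from f obtain c where "\<And>p. p \<in> {1..r} \<Longrightarrow> f p = bilin m n (c p)"
    unfolding bilinear_form_iff by metis
  with P show "\<exists>c. \<forall>x y. P x y = (\<Sum>p\<in>{1..r}. (bilin m n (c p) x y)\<^sup>2)"
    by (intro exI[of _ c]) simp
next
  assume "\<exists>c. \<forall>x y. P x y = (\<Sum>p\<in>{1..r}. (bilin m n (c p) x y)\<^sup>2)"
  then obtain c where "\<forall>x y. P x y = (\<Sum>p\<in>{1..r}. (bilin m n (c p) x y)\<^sup>2)" ..
  then show "sum_of_squares m n r P"
    unfolding sum_of_squares_def bilinear_form_iff by (intro exI[of _ "\<lambda>p. bilin m n (c p)"]) auto
qed

lemma sum_of_squares_cardI:
  assumes "finite A" and P: "\<And>x y. P x y = (\<Sum>e\<in>A. (bilin m n (c e) x y)\<^sup>2)"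
  shows "sum_of_squares m n (card A) P"
proof -
  obtain h where h: "bij_betw h {1..card A} A"
    using ex_bij_betw_nat_finite_1[OF assms(1)] by blast
  have "P x y = (\<Sum>p\<in>{1..card A}. (bilin m n (c (h p)) x y)\<^sup>2)" for x y
    unfolding P using sum.reindex_bij_betw[OF h, of "\<lambda>e. (bilin m n (c e) x y)\<^sup>2"] by simp
  then show ?thesis
    unfolding sum_of_squares_iff by (intro exI[of _ "\<lambda>p. c (h p)"]) simp
qed

section \<open>Gram matrices of coefficient vectors\<close>

definition gram :: "'a set \<Rightarrow> ('a \<Rightarrow> 'b \<Rightarrow> real) \<Rightarrow> 'b \<Rightarrow> 'b \<Rightarrow> real" where
  "gram I v a b = (\<Sum>p\<in>I. v p a * v p b)"

lemma gram_commute: "gram I v a b = gram I v b a"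
  by (simp add: gram_def mult.commute)

lemma gram_diff:
  "(\<Sum>p\<in>I. (v p a - v p b)\<^sup>2) = gram I v a a - 2 * gram I v a b + gram I v b b"
proof -
  have "(\<Sum>p\<in>I. (v p a - v p b)\<^sup>2) = (\<Sum>p\<in>I. v p a * v p a - 2 * (v p a * v p b) + v p b * v p b)"
    by (rule sum.cong) (auto simp: power2_eq_square algebra_simps)
  then show ?thesis
    by (simp add: gram_def sum.distrib sum_subtractf sum_distrib_left)
qed

lemma gram_self_eq_0D:
  assumes "finite I" and "gram I v a a = 0" and "p \<in> I"
  shows "v p a = 0"
  using assms by (simp add: gram_def sum_nonneg_eq_0_iff)

lemma gram_zero:
  assumes "\<And>p. p \<in> I \<Longrightarrow> v p a = 0"
  shows "gram I v a b = 0" "gram I v b a = 0"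
  using assms by (simp_all add: gram_def)

lemma gram_cong:
  assumes "\<And>p. p \<in> I \<Longrightarrow> v p a = v p a'" and "\<And>p. p \<in> I \<Longrightarrow> v p b = v p b'"
  shows "gram I v a b = gram I v a' b'"
  using assms by (simp add: gram_def)

lemma sum_bilin_square:
  "(\<Sum>p\<in>I. (bilin m n (v p) x y)\<^sup>2) =
    (\<Sum>a\<in>cells m n. \<Sum>b\<in>cells m n. gram I v a b * x (fst a) * y (snd a) * x (fst b) * y (snd b))"
proof -
  have "(\<Sum>p\<in>I. (bilin m n (v p) x y)\<^sup>2) =
    (\<Sum>p\<in>I. \<Sum>a\<in>cells m n. \<Sum>b\<in>cells m n.
      (v p a * x (fst a) * y (snd a)) * (v p b * x (fst b) * y (snd b)))"
    by (simp add: bilin_cells power2_eq_square sum_product)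
  also have "\<dots> = (\<Sum>a\<in>cells m n. \<Sum>b\<in>cells m n. \<Sum>p\<in>I.
      (v p a * x (fst a) * y (snd a)) * (v p b * x (fst b) * y (snd b)))"
    by (subst sum.swap, rule sum.cong, simp, subst sum.swap, simp)
  also have "\<dots> = (\<Sum>a\<in>cells m n. \<Sum>b\<in>cells m n.
      gram I v a b * x (fst a) * y (snd a) * x (fst b) * y (snd b))"
    by (intro sum.cong refl) (simp add: gram_def sum_distrib_left sum_distrib_right mult_ac)
  finally show ?thesis .
qed

lemma gram_shear:
  "gram I (\<lambda>p a. v p a - s a * v p z) a b =
    gram I v a b - s b * gram I v z a - s a * gram I v z b + s a * s b * gram I v z z"
proof -
  have "gram I (\<lambda>p a. v p a - s a * v p z) a b =
      (\<Sum>p\<in>I. v p a * v p b - s b * (v p z * v p a) - s a * (v p z * v p b) + s a * s b * (v p z * v p z))"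
    unfolding gram_def by (rule sum.cong) (simp_all add: algebra_simps)
  then show ?thesis
    by (simp only: gram_def sum.distrib sum_subtractf sum_distrib_left)
qed

text \<open>Gram--Schmidt, with the set \<open>A\<close> also indexing the coordinates of the new vectors.\<close>

lemma gram_reduction:
  assumes "finite A" and I: "finite I"
  shows "\<exists>L. \<forall>a\<in>A. \<forall>b\<in>A. gram I v a b = gram A L a b"
  using assms(1)
proof (induction A arbitrary: v)
  case empty
  then show ?case by simp
next
  case (insert z A)
  let ?G = "gram I v"
  \<comment> \<open>Projection to the orthogonal complement of the vector of \<open>z\<close>. If
    that vector is zero, the division by zero gives 0 and nothing is subtracted.\<close>
  define v' where "v' p a = v p a - ?G z a / ?G z z * v p z" for p a
  obtain L' where L': "\<And>a b. a \<in> A \<Longrightarrow> b \<in> A \<Longrightarrow> gram I v' a b = gram A L' a b"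
    using insert.IH[of v'] by blast
  have z0: "?G z b = 0" if "?G z z = 0" for b
    using gram_zero(1)[of I v z b] gram_self_eq_0D[OF I that] by blast
  have G0: "?G z z \<ge> 0"
    by (simp add: gram_def sum_nonneg)
  have G': "gram I v' a b = ?G a b - ?G z a * ?G z b / ?G z z" for a b
    using gram_shear[of I v "\<lambda>a. ?G z a / ?G z z" z a b]
    by (cases "?G z z = 0") (simp_all add: v'_def[abs_def])
  \<comment> \<open>Coordinate \<open>z\<close> is the component along the normalised vector of
    \<open>z\<close>. The other coordinates represent the projections by induction and are 0 at
    \<open>z\<close>, whose projection vanishes.\<close>
  define L where "L q a = (if q = z then ?G z a / sqrt (?G z z) else if a = z then 0 else L' q a)"
    for q a
  have *: "gram (insert z A) L a b = ?G z a * ?G z b / ?G z z + (\<Sum>q\<in>A. L q a * L q b)" for a b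
    using insert.hyps G0 by (simp add: gram_def[of "insert z A"] L_def)
  have "?G a b = gram (insert z A) L a b" if "a \<in> insert z A" "b \<in> insert z A" for a b
  proof (cases "a = z \<or> b = z")
    case True
    have "(\<Sum>q\<in>A. L q a * L q b) = 0"
      using True insert.hyps by (intro sum.neutral) (auto simp: L_def)
    then show ?thesis
      using True z0[of a] z0[of b] gram_commute[of I v a z] unfolding *
      by (cases "?G z z = 0") auto
  next
    case False
    with that have "a \<in> A" "b \<in> A" by auto
    moreover have "(\<Sum>q\<in>A. L q a * L q b) = gram A L' a b"
      using False insert.hyps unfolding gram_def by (intro sum.cong) (auto simp: L_def)
    ultimately show ?thesis
      using L'[of a b] G'[of a b] unfolding * by simp
  qed
  then show ?case by blast
qed

section \<open>Finiteness of the set of SOS ranks\<close>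

lemma SOS_rank_le:
  assumes "is_SOS m n P"
  shows "SOS_rank m n P \<le> m * n"
proof -
  obtain r :: nat and c where P: "\<And>x y. P x y = (\<Sum>p\<in>{1..r}. (bilin m n (c p) x y)\<^sup>2)"
    using assms unfolding is_SOS_def sum_of_squares_iff by blast
  \<comment> \<open>The form depends only on the Gram matrix, so the squares can be re-indexed by
    the \<open>m * n\<close> cells, however large \<open>r\<close> is.\<close>
  obtain L where L: "\<And>a b. a \<in> cells m n \<Longrightarrow> b \<in> cells m n \<Longrightarrow>
      gram {1..r} c a b = gram (cells m n) L a b"
    using gram_reduction[of "cells m n" "{1..r}" c] by auto
  have "P x y = (\<Sum>q\<in>cells m n. (bilin m n (L q) x y)\<^sup>2)" for x y
    unfolding P sum_bilin_square by (intro sum.cong refl) (simp only: L)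
  then have "sum_of_squares m n (card (cells m n)) P"
    by (intro sum_of_squares_cardI) auto
  then show ?thesis
    unfolding SOS_rank_def card_cells by (rule Least_le)
qed

text \<open>The bound \<open>m * n\<close> makes the set of ranks finite, so its \<open>Max\<close>
  is an upper bound.\<close>

lemma SOS_rank_le_BSR:
  assumes "biquadratic_form m n P" and "is_SOS m n P"
  shows "SOS_rank m n P \<le> BSR m n"
proof -
  have "{SOS_rank m n P | P. biquadratic_form m n P \<and> is_SOS m n P} \<subseteq> {..m * n}"
    using SOS_rank_le by auto
  then have "finite {SOS_rank m n P | P. biquadratic_form m n P \<and> is_SOS m n P}"
    by (rule finite_subset) simp
  then show ?thesis
    unfolding BSR_def using assms by (intro Max_ge) auto
qed

lemma is_SOS_imp_biquadratic_form:
  assumes "is_SOS m n P"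
  shows "biquadratic_form m n P"
proof -
  obtain r :: nat and c where P: "\<And>x y. P x y = (\<Sum>p\<in>{1..r}. (bilin m n (c p) x y)\<^sup>2)"
    using assms unfolding is_SOS_def sum_of_squares_iff by blast
  let ?g = "\<lambda>i j k l. gram {1..r} c (i, j) (k, l)"
  \<comment> \<open>The Gram coefficients are symmetric under exchange of the two cells. Averaging
    with \<open>i\<close> and \<open>k\<close> swapped adds the symmetry
    \<open>a i j k l = a k j i l\<close> without changing the form.\<close>
  define a where "a i j k l = (?g i j k l + ?g k j i l) / 2" for i j k l
  let ?S = "\<lambda>h x y. \<Sum>i\<in>{1..m}. \<Sum>k\<in>{1..m}. \<Sum>j\<in>{1..n}. \<Sum>l\<in>{1..n}. h i j k l * x i * x k * y j * y l"
  have P1: "P x y = ?S ?g x y" for x y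
  proof -
    have "P x y = (\<Sum>i\<in>{1..m}. \<Sum>j\<in>{1..n}. \<Sum>k\<in>{1..m}. \<Sum>l\<in>{1..n}. ?g i j k l * x i * y j * x k * y l)"
      unfolding P sum_bilin_square unfolding cells_def sum.cartesian_product'
      by simp
    also have "\<dots> = (\<Sum>i\<in>{1..m}. \<Sum>k\<in>{1..m}. \<Sum>j\<in>{1..n}. \<Sum>l\<in>{1..n}. ?g i j k l * x i * y j * x k * y l)"
      by (intro sum.cong refl sum.swap)
    finally show ?thesis by (simp add: mult_ac)
  qed
  have P2: "P x y = ?S (\<lambda>i j k l. ?g k j i l) x y" for x y
    unfolding P1 by (subst sum.swap) (simp add: mult_ac)
  have "?S a x y = (?S ?g x y + ?S (\<lambda>i j k l. ?g k j i l) x y) / 2" for x y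
    unfolding a_def by (simp add: sum.distrib[symmetric] sum_divide_distrib field_simps)
  then have "P x y = ?S a x y" for x y
    using P1 P2 by simp
  moreover have "a i j k l = a k j i l" "a i j k l = a k l i j" for i j k l
    using gram_commute[of "{1..r}" c "(i, l)" "(k, j)"] gram_commute[of "{1..r}" c "(i, j)" "(k, l)"]
    by (simp_all add: a_def)
  ultimately show ?thesis
    unfolding biquadratic_form_def by (intro exI[of _ a]) auto
qed

section \<open>Polarisation of a sum of squares\<close>

lemma bilin_two_point:
  assumes "i \<in> {1..m}" "k \<in> {1..m}" "j \<in> {1..n}" "l \<in> {1..n}"
  shows "bilin m n c (\<lambda>r. of_bool (r = i) + s * of_bool (r = k)) (\<lambda>r. of_bool (r = j) + t * of_bool (r = l))
    = c (i, j) + t * c (i, l) + s * c (k, j) + s * t * c (k, l)"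
proof -
  have y: "(\<Sum>q\<in>{1..n}. c (p, q) * w * (of_bool (q = j) + t * of_bool (q = l)))
      = w * (c (p, j) + t * c (p, l))" for p w
    using assms by (simp add: distrib_left sum.distrib of_bool_def if_distrib[of "\<lambda>z. _ * z"] cong: if_cong)
  show ?thesis
    unfolding bilin_def y using assms
    by (simp add: distrib_right sum.distrib of_bool_def if_distrib[of "\<lambda>z. z * _"] if_distrib[of "\<lambda>z. _ * z"] cong: if_cong)
       (simp add: algebra_simps)
qed

text \<open>Polarisation: the mixed second difference isolates the coefficient of \<open>s t\<close>.\<close>

lemma sum_bilin_square_polarisation:
  fixes x y :: "real \<Rightarrow> nat \<Rightarrow> real" and I :: "'a set" and v :: "'a \<Rightarrow> cell \<Rightarrow> real"
  assumes ij: "i \<in> {1..m}" "k \<in> {1..m}" "j \<in> {1..n}" "l \<in> {1..n}"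
  defines "x \<equiv> \<lambda>s r. of_bool (r = i) + s * of_bool (r = k)"
    and "y \<equiv> \<lambda>t r. of_bool (r = j) + t * of_bool (r = l)"
    and "Q \<equiv> \<lambda>x y. \<Sum>p\<in>I. (bilin m n (v p) x y)\<^sup>2"
  shows "Q (x 1) (y 1) - Q (x 1) (y (-1)) - Q (x (-1)) (y 1) + Q (x (-1)) (y (-1)) =
    8 * (gram I v (i, j) (k, l) + gram I v (i, l) (k, j))"
proof -
  \<comment> \<open>Here \<open>a\<close>, \<open>b\<close>, \<open>c\<close>, \<open>d\<close> are
    the coefficients of 1, \<open>t\<close>, \<open>s\<close>, \<open>s * t\<close>. In the square,
    \<open>s * t\<close> has coefficient \<open>2 * (a * d + b * c)\<close>, and the alternating sum
    over the four sign choices multiplies it by 4.\<close>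
  have id: "(a + b + c + d)\<^sup>2 - (a - b + c - d)\<^sup>2 - (a + b - c - d)\<^sup>2 + (a - b - c + d)\<^sup>2 =
      8 * (a * d + b * c)" for a b c d :: real
    by (simp add: power2_eq_square algebra_simps)
  have B: "bilin m n (v p) (x s) (y t) = v p (i, j) + t * v p (i, l) + s * v p (k, j) + s * t * v p (k, l)"
    for p s t
    unfolding x_def y_def by (rule bilin_two_point[OF ij])
  have "Q (x 1) (y 1) - Q (x 1) (y (-1)) - Q (x (-1)) (y 1) + Q (x (-1)) (y (-1)) =
      (\<Sum>p\<in>I. (bilin m n (v p) (x 1) (y 1))\<^sup>2 - (bilin m n (v p) (x 1) (y (-1)))\<^sup>2
        - (bilin m n (v p) (x (-1)) (y 1))\<^sup>2 + (bilin m n (v p) (x (-1)) (y (-1)))\<^sup>2)"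
    unfolding Q_def by (simp only: sum.distrib sum_subtractf)
  also have "\<dots> = (\<Sum>p\<in>I. 8 * (v p (i, j) * v p (k, l) + v p (i, l) * v p (k, j)))"
    unfolding B id[symmetric] by simp
  also have "\<dots> = 8 * (gram I v (i, j) (k, l) + gram I v (i, l) (k, j))"
    by (simp only: gram_def sum.distrib sum_distrib_left[symmetric])
  finally show ?thesis .
qed

text \<open>The form fixes only the sum over the two diagonals of a rectangle. Coinciding rows or
  columns are allowed, and those cases later yield single inner products.\<close>

lemma gram_polarisation:
  assumes eq: "\<And>x y. (\<Sum>p\<in>I. (bilin m n (v p) x y)\<^sup>2) = (\<Sum>q\<in>J. (bilin m n (w q) x y)\<^sup>2)"
    and ij: "i \<in> {1..m}" "k \<in> {1..m}" "j \<in> {1..n}" "l \<in> {1..n}"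
  shows "gram I v (i, j) (k, l) + gram I v (i, l) (k, j) = gram J w (i, j) (k, l) + gram J w (i, l) (k, j)"
  using sum_bilin_square_polarisation[OF ij, where I = I and v = v]
    sum_bilin_square_polarisation[OF ij, where I = J and v = w]
  unfolding eq by simp

section \<open>The size of an orthonormal family\<close>

lemma card_orthonormal_le:
  fixes u :: "'a \<Rightarrow> 'b \<Rightarrow> real"
  assumes A: "finite A" and I: "finite I"
    and on: "\<And>a b. a \<in> A \<Longrightarrow> b \<in> A \<Longrightarrow> (\<Sum>p\<in>I. u a p * u b p) = of_bool (a = b)"
  shows "card A \<le> card I"
proof -
  have bessel: "(\<Sum>a\<in>A. (u a q)\<^sup>2) \<le> 1" if q: "q \<in> I" for q
  proof -
    let ?S = "\<Sum>a\<in>A. (u a q)\<^sup>2"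
    \<comment> \<open>The orthogonal projection of the \<open>q\<close>-th unit vector to the span
      of the family. Its squared norm and its \<open>q\<close>-th coordinate both equal
      \<open>?S\<close>, so its squared distance to the unit vector is
      \<open>1 - ?S\<close>.\<close>
    let ?w = "\<lambda>p. \<Sum>a\<in>A. u a q * u a p"
    have "(\<Sum>p\<in>I. (?w p)\<^sup>2) = (\<Sum>p\<in>I. \<Sum>a\<in>A. \<Sum>b\<in>A. (u a q * u a p) * (u b q * u b p))"
      by (simp add: power2_eq_square sum_product)
    also have "\<dots> = (\<Sum>a\<in>A. \<Sum>b\<in>A. \<Sum>p\<in>I. (u a q * u a p) * (u b q * u b p))"
      by (subst sum.swap, rule sum.cong, simp, subst sum.swap, simp)
    also have "\<dots> = (\<Sum>a\<in>A. \<Sum>b\<in>A. u a q * u b q * (\<Sum>p\<in>I. u a p * u b p))"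
      by (simp add: sum_distrib_left mult_ac)
    also have "\<dots> = (\<Sum>a\<in>A. \<Sum>b\<in>A. u a q * u b q * of_bool (a = b))"
      by (intro sum.cong refl) (simp add: on)
    also have "\<dots> = ?S"
      using A by (simp add: power2_eq_square of_bool_def if_distrib[of "\<lambda>z. _ * z"] cong: if_cong)
    finally have w2: "(\<Sum>p\<in>I. (?w p)\<^sup>2) = ?S" .
    have wq: "(\<Sum>p\<in>I. of_bool (p = q) * ?w p) = ?S"
      using I q by (simp add: power2_eq_square of_bool_def if_distrib[of "\<lambda>z. z * _"] cong: if_cong)
    have "0 \<le> (\<Sum>p\<in>I. (of_bool (p = q) - ?w p)\<^sup>2)"
      by (simp add: sum_nonneg)
    also have "\<dots> = (\<Sum>p\<in>I. of_bool (p = q) - 2 * (of_bool (p = q) * ?w p) + (?w p)\<^sup>2)"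
      by (rule sum.cong) (simp_all add: power2_eq_square algebra_simps)
    also have "\<dots> = (\<Sum>p\<in>I. of_bool (p = q)) - 2 * (\<Sum>p\<in>I. of_bool (p = q) * ?w p) + (\<Sum>p\<in>I. (?w p)\<^sup>2)"
      by (simp only: sum.distrib sum_subtractf sum_distrib_left)
    also have "(\<Sum>p\<in>I. of_bool (p = q)) = (1::real)"
      using I q by (simp add: of_bool_def)
    finally show ?thesis
      unfolding w2 wq by simp
  qed
  \<comment> \<open>Double counting of the squared entries: each vector contributes 1, each
    coordinate at most 1.\<close>
  have "real (card A) = (\<Sum>a\<in>A. \<Sum>q\<in>I. (u a q)\<^sup>2)"
    using on by (simp add: power2_eq_square)
  also have "\<dots> = (\<Sum>q\<in>I. \<Sum>a\<in>A. (u a q)\<^sup>2)"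
    by (rule sum.swap)
  also have "\<dots> \<le> (\<Sum>q\<in>I. 1)"
    by (rule sum_mono) (rule bessel)
  finally show ?thesis by simp
qed

section \<open>Weakly admissible graphs\<close>

lemma edges_in_cells:
  assumes "augmented_graph m n E1 E2" and "e \<in> edges E1 E2"
  shows "e \<subseteq> cells m n" "e \<noteq> {}"
  using assms by (auto simp: augmented_graph_def edges_def)

lemma augmented_graph_finite:
  assumes "augmented_graph m n E1 E2"
  shows "finite E1" "finite E2" "finite (edges E1 E2)"
proof -
  show *: "finite E1"
    using assms finite_subset[OF _ finite_cells] by (auto simp: augmented_graph_def)
  have "E2 \<subseteq> Pow (cells m n)"
    using assms by (auto simp: augmented_graph_def)
  then show **: "finite E2"
    by (rule finite_subset) simp
  have "edges E1 E2 = (\<lambda>c. {c}) ` E1 \<union> E2"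
    by (auto simp: edges_def)
  then show "finite (edges E1 E2)"
    using * ** by simp
qed

lemma card_edges:
  assumes "augmented_graph m n E1 E2"
  shows "card (edges E1 E2) = card E1 + card E2"
proof -
  have "edges E1 E2 = (\<lambda>c. {c}) ` E1 \<union> E2"
    by (auto simp: edges_def)
  moreover have "(\<lambda>c. {c}) ` E1 \<inter> E2 = {}"
    using assms by (auto simp: augmented_graph_def doubleton_eq_iff)
  ultimately show ?thesis
    using augmented_graph_finite[OF assms] by (simp add: card_Un_disjoint card_image)
qed

lemma occupied_eq_Union_edges: "occupied E1 E2 = \<Union>(edges E1 E2)"
  by (auto simp: occupied_def edges_def)

lemma edges_disjoint:
  assumes S: "cond_S E1 E2" and "e \<in> edges E1 E2" "f \<in> edges E1 E2" "a \<in> e" "a \<in> f"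
  shows "e = f"
proof -
  from S have S1: "e \<inter> E1 = {}" if "e \<in> E2" for e
    using that by (simp add: cond_S_def)
  have S2: "e = f" if "e \<in> E2" "f \<in> E2"
  proof (rule ccontr)
    assume "e \<noteq> f"
    with S that have "e \<inter> f = {}"
      by (simp add: cond_S_def)
    with assms(4,5) show False by blast
  qed
  have "e = {a} \<and> a \<in> E1 \<or> e \<in> E2 \<and> a \<notin> E1" "f = {a} \<and> a \<in> E1 \<or> f \<in> E2 \<and> a \<notin> E1"
    using assms(2-5) S1 by (auto simp: edges_def)
  then show ?thesis
    using S2 by blast
qed

lemma opposite_cells_doubleton:
  assumes "i \<noteq> k" "j \<noteq> l"
  shows "opposite_cells {(i, j), (k, l)} = {(i, l), (k, j)}"
proof
  show "opposite_cells {(i, j), (k, l)} \<subseteq> {(i, l), (k, j)}"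
    by (auto simp: opposite_cells_def doubleton_eq_iff)
  have "{(i, j), (k, l)} = {(k, l), (i, j)}"
    by auto
  with assms show "{(i, l), (k, j)} \<subseteq> opposite_cells {(i, j), (k, l)}"
    unfolding opposite_cells_def by blast
qed

section \<open>The dependency order on 2-edges\<close>

definition has_complement :: "edge2 set \<Rightarrow> edge2 \<Rightarrow> bool" where
  "has_complement E2 e \<longleftrightarrow> (\<exists>e'\<in>E2. complementary e e')"

text \<open>Deleting the arcs that leave a 2-edge with a complement breaks the only cycles (W2)
  tolerates, and a finite acyclic relation is well-founded. The pairs are reversed so that induction
  at \<open>e\<close> covers the heads of the arcs leaving \<open>e\<close>.\<close>

lemma wf_dependency:
  assumes "augmented_graph m n E1 E2" and W2: "cond_W2 E1 E2"
  shows "wf {(e', e). (e, e') \<in> parcs (dependency_graph E1 E2) \<and> \<not> has_complement E2 e}"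
proof -
  define D where "D = dependency_graph E1 E2"
  define H where "H = \<lparr> pverts = pverts D, parcs = {(e, e') \<in> parcs D. \<not> has_complement E2 e} \<rparr>"
  have D: "pair_wf_digraph D"
    by unfold_locales (auto simp: D_def dependency_graph_def)
  have H: "pair_wf_digraph H"
    by unfold_locales (auto simp: H_def D_def dependency_graph_def)
  interpret D: pair_wf_digraph D by (rule D)
  interpret H: pair_wf_digraph H by (rule H)
  have sub: "subgraph (with_proj H) (with_proj D)"
    using D.wf_digraph_axioms H.wf_digraph_axioms
    by (auto simp: subgraph_def compatible_def H_def)
  have "acyclic (parcs H)"
  proof (rule acyclicI, intro allI notI)
    fix e assume "(e, e) \<in> (parcs H)\<^sup>+"
    then obtain p where "pre_digraph.awalk (with_proj H) e p e" "p \<noteq> []"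
      using H.reachable1_awalk by auto
    then have "H.closed_w p"
      unfolding H.closed_w_def by auto
    \<comment> \<open>\<open>cond_W2\<close> constrains cycles only, so one is extracted from the
      closed walk.\<close>
    then obtain p where p: "pre_digraph.cycle (with_proj H) p"
      using H.closed_w_imp_cycle by blast
    then have "pre_digraph.cycle (with_proj D) p"
      by (rule D.subgraph_cycle[OF sub])
    then obtain e e' where e: "complementary e e'" "p = [(e, e'), (e', e)]"
      using W2 unfolding cond_W2_def D_def by blast
    have "set p \<subseteq> parcs H"
      using p by (auto simp: H.cycle_def H.awalk_def)
    \<comment> \<open>Arcs leaving \<open>e\<close> were deleted in \<open>H\<close>, since
      \<open>e'\<close> complements it.\<close>
    then have "(e, e') \<in> parcs H"
      using e by simp
    then have "\<not> has_complement E2 e" "e' \<in> E2"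
      by (auto simp: H_def D_def dependency_graph_def)
    then show False
      using e by (auto simp: has_complement_def)
  qed
  then have "acyclic ((parcs H)\<inverse>)"
    by simp
  moreover have "finite ((parcs H)\<inverse>)"
  proof -
    have "parcs H \<subseteq> E2 \<times> E2"
      by (auto simp: H_def D_def dependency_graph_def)
    then show ?thesis
      using augmented_graph_finite(2)[OF assms(1)] finite_subset by fastforce
  qed
  moreover have "(parcs H)\<inverse> = {(e', e). (e, e') \<in> parcs (dependency_graph E1 E2) \<and> \<not> has_complement E2 e}"
    by (auto simp: H_def D_def)
  ultimately show ?thesis
    using finite_acyclic_wf by metis
qed

section \<open>The edge form and its representations\<close>

definition edge_form :: "nat \<Rightarrow> nat \<Rightarrow> cell set \<Rightarrow> edge2 set \<Rightarrow> form" where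
  "edge_form m n E1 E2 x y = (\<Sum>e\<in>edges E1 E2. (bilin m n (\<lambda>c. of_bool (c \<in> e)) x y)\<^sup>2)"

lemma sum_of_squares_edge_form:
  assumes "augmented_graph m n E1 E2"
  shows "sum_of_squares m n (card (edges E1 E2)) (edge_form m n E1 E2)"
  using augmented_graph_finite(3)[OF assms] by (rule sum_of_squares_cardI) (simp add: edge_form_def)

text \<open>
  \<open>v\<close> collects the coefficients of an arbitrary representation of the edge form as a sum of
  squares: the cell \<open>c\<close> carries the vector \<open>\<lambda>p. v p c\<close>.
\<close>

locale edge_form_representation =
  fixes m n :: nat and E1 :: "cell set" and E2 :: "edge2 set"
    and I :: "nat set" and v :: "nat \<Rightarrow> cell \<Rightarrow> real"
  assumes adm: "weakly_admissible m n E1 E2"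
    and finI: "finite I"
    and rep: "\<And>x y. edge_form m n E1 E2 x y = (\<Sum>p\<in>I. (bilin m n (v p) x y)\<^sup>2)"
begin

abbreviation "E \<equiv> edges E1 E2"
abbreviation "Occ \<equiv> occupied E1 E2"
abbreviation "g \<equiv> gram I v"

definition same_edge :: "cell \<Rightarrow> cell \<Rightarrow> bool" where
  "same_edge a b \<longleftrightarrow> (\<exists>e\<in>E. a \<in> e \<and> b \<in> e)"

definition coherent :: "cell set \<Rightarrow> bool" where
  "coherent e \<longleftrightarrow> (\<forall>a\<in>e. \<forall>b\<in>e. \<forall>p\<in>I. v p a = v p b)"

lemma aug: "augmented_graph m n E1 E2" and S: "cond_S E1 E2" and W1: "C4_free E1"
  and W2: "cond_W2 E1 E2" and W2': "cond_W2' E1 E2" and W3: "cond_W3 E1 E2"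
  using adm by (auto simp: weakly_admissible_def cond_W1_def)

text \<open>By (S) a cell lies in at most one edge, so at most one summand is nonzero.\<close>

lemma gram_indicator: "gram E (\<lambda>e c. of_bool (c \<in> e)) a b = of_bool (same_edge a b)"
proof (cases "same_edge a b")
  case True
  then obtain e where e: "e \<in> E" "a \<in> e" "b \<in> e"
    by (auto simp: same_edge_def)
  have "gram E (\<lambda>e c. of_bool (c \<in> e)) a b = (\<Sum>f\<in>E. of_bool (f = e))"
    unfolding gram_def
  proof (rule sum.cong)
    fix f assume "f \<in> E"
    then have "a \<in> f \<and> b \<in> f \<longleftrightarrow> f = e"
      using e edges_disjoint[OF S] by blast
    then show "of_bool (a \<in> f) * of_bool (b \<in> f) = (of_bool (f = e) :: real)"
      by auto
  qed simp
  also have "\<dots> = 1"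
    using e augmented_graph_finite(3)[OF aug] by (simp add: of_bool_def)
  finally show ?thesis using True by simp
next
  case False
  then show ?thesis
    unfolding gram_def same_edge_def by (intro sum.neutral[THEN trans]) auto
qed

text \<open>Polarisation of \<open>rep\<close> against the defining squares of the edge form, whose
  inner products are 0 or 1 by \<open>gram_indicator\<close>.\<close>

lemma gram_relation:
  assumes "(i, j) \<in> cells m n" "(k, l) \<in> cells m n"
  shows "g (i, j) (k, l) + g (i, l) (k, j) =
    of_bool (same_edge (i, j) (k, l)) + of_bool (same_edge (i, l) (k, j))"
proof -
  have ij: "i \<in> {1..m}" "k \<in> {1..m}" "j \<in> {1..n}" "l \<in> {1..n}"
    using assms by (auto simp: cells_def)
  have "(\<Sum>p\<in>I. (bilin m n (v p) x y)\<^sup>2) = (\<Sum>e\<in>E. (bilin m n (\<lambda>c. of_bool (c \<in> e)) x y)\<^sup>2)" for x y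
    using rep[of x y] by (simp add: edge_form_def)
  from gram_polarisation[OF this ij] show ?thesis
    unfolding gram_indicator .
qed

text \<open>On a common line the rectangle collapses: both diagonals are the same pair of cells, so
  \<open>gram_relation\<close> is twice the claim.\<close>

lemma gram_same_line:
  assumes "a \<in> cells m n" "b \<in> cells m n" "fst a = fst b \<or> snd a = snd b"
  shows "g a b = of_bool (same_edge a b)"
proof -
  obtain i j k l where ab: "a = (i, j)" "b = (k, l)"
    by (metis surj_pair)
  have "same_edge b a = same_edge a b"
    unfolding same_edge_def by blast
  moreover have "g b a = g a b"
    by (rule gram_commute)
  moreover have "i = k \<or> j = l"
    using assms(3) ab by simp
  ultimately show ?thesis
    using gram_relation[of i j k l] assms(1,2) unfolding ab by (elim disjE) simp_all
qed

lemma gram_self: "a \<in> cells m n \<Longrightarrow> g a a = of_bool (a \<in> Occ)"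
  by (simp add: gram_same_line same_edge_def occupied_eq_Union_edges Bex_def)

lemma edge_cells: "e \<in> E \<Longrightarrow> a \<in> e \<Longrightarrow> a \<in> cells m n"
  using edges_in_cells[OF aug] by blast

lemma same_edgeD: "same_edge a b \<Longrightarrow> a \<in> Occ \<and> b \<in> Occ"
  by (auto simp: same_edge_def occupied_eq_Union_edges)

lemma not_same_edge: "e \<in> E \<Longrightarrow> f \<in> E \<Longrightarrow> e \<noteq> f \<Longrightarrow> a \<in> e \<Longrightarrow> b \<in> f \<Longrightarrow> \<not> same_edge a b"
  unfolding same_edge_def using edges_disjoint[OF S] by blast

lemma gram_unoccupied:
  assumes "a \<in> cells m n" "a \<notin> Occ"
  shows "g a b = 0" "g b a = 0"
proof -
  have "g a a = 0"
    using gram_self assms by simp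
  then have "v p a = 0" if "p \<in> I" for p
    using gram_self_eq_0D[OF finI] that by metis
  then show "g a b = 0" "g b a = 0"
    by (simp_all add: gram_zero)
qed

text \<open>Cauchy-Schwarz for vectors of norm 0 or 1, read off from the squared distance.\<close>

lemma gram_le_1:
  assumes "a \<in> cells m n" "b \<in> cells m n"
  shows "g a b \<le> 1"
proof -
  have "0 \<le> (\<Sum>p\<in>I. (v p a - v p b)\<^sup>2)"
    by (simp add: sum_nonneg)
  also have "\<dots> = g a a - 2 * g a b + g b b"
    by (rule gram_diff)
  also have "\<dots> \<le> 2 - 2 * g a b"
    using gram_self assms by simp
  finally show ?thesis by simp
qed

text \<open>The equality case: the squared distance is at most \<open>1 - 2 + 1 = 0\<close>.\<close>

lemma gram_eq_1D:
  assumes "a \<in> cells m n" "b \<in> cells m n" "g a b = 1" "p \<in> I"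
  shows "v p a = v p b"
proof -
  have "(\<Sum>p\<in>I. (v p a - v p b)\<^sup>2) = g a a - 2 * g a b + g b b"
    by (rule gram_diff)
  also have "\<dots> \<le> 0"
    using gram_self assms by simp
  finally have "(\<Sum>p\<in>I. (v p a - v p b)\<^sup>2) = 0"
    by (intro antisym sum_nonneg) simp_all
  then show ?thesis
    using finI \<open>p \<in> I\<close> by (simp add: sum_nonneg_eq_0_iff)
qed

section \<open>Coherence of the 2-edges\<close>

lemma E2_doubletonE:
  assumes "e \<in> E2"
  obtains i j k l where "e = {(i, j), (k, l)}" "(i, j) \<in> cells m n" "(k, l) \<in> cells m n"
    "(i, j) \<noteq> (k, l)"
proof -
  have "\<exists>c d. e = {c, d} \<and> c \<in> cells m n \<and> d \<in> cells m n \<and> c \<noteq> d"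
    using assms aug by (auto simp: augmented_graph_def)
  then show thesis
    using that by (metis surj_pair)
qed

lemma E2_E: "e \<in> E2 \<Longrightarrow> e \<in> E"
  by (simp add: edges_def)

lemma coherentI_gram:
  assumes "(i, j) \<in> cells m n" "(k, l) \<in> cells m n" "g (i, j) (k, l) = 1"
  shows "coherent {(i, j), (k, l)}"
  using gram_eq_1D[OF assms] by (auto simp: coherent_def)

text \<open>Coherence makes \<open>g\<close> constant on \<open>e \<times> f\<close>, so a single
  orthogonal pair suffices. A shared row or column supplies it directly; otherwise (W3) does,
  through an unoccupied opposite cell.\<close>

lemma coherent_orthogonal:
  assumes e: "e \<in> E" "coherent e" and f: "f \<in> E" "coherent f"
    and "e \<noteq> f" and two: "e \<in> E2 \<or> f \<in> E2" and ab: "a \<in> e" "b \<in> f"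
  shows "g a b = 0"
proof -
  have "\<exists>a'\<in>e. \<exists>b'\<in>f. g a' b' = 0"
  proof (cases "vertex_disjoint e f")
    case True
    have "\<exists>c\<in>pair_opposite_cells e f. c \<notin> Occ"
      using W3[unfolded cond_W3_def, rule_format, OF e(1) f(1)] two True by simp
    then obtain c where c: "c \<in> pair_opposite_cells e f" "c \<notin> Occ" ..
    have "\<exists>a\<in>e. \<exists>b\<in>f. c = (fst a, snd b) \<or> c = (fst b, snd a)"
      using c(1) unfolding pair_opposite_cells_def row_set_def col_set_def by blast
    \<comment> \<open>An opposite cell is a corner of the rectangle spanned by a cell of
      \<open>e\<close> and a cell of \<open>f\<close>. Being unoccupied, it carries the zero vector;
      one diagonal vanishes and \<open>gram_relation\<close> makes the other vanish too.\<close>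
    then obtain i j k l where ij: "(i, j) \<in> e" "(k, l) \<in> f" "c = (i, l) \<or> c = (k, j)"
      by auto
    have cells: "(i, j) \<in> cells m n" "(k, l) \<in> cells m n"
      using edge_cells[OF e(1) ij(1)] edge_cells[OF f(1) ij(2)] by simp_all
    then have "(i, l) \<in> cells m n" "(k, j) \<in> cells m n"
      by (auto simp: cells_def)
    then have "g (i, l) (k, j) = 0" "\<not> same_edge (i, l) (k, j)"
      using c(2) ij(3) gram_unoccupied[of c] same_edgeD[of "(i, l)" "(k, j)"] by auto
    moreover have "\<not> same_edge (i, j) (k, l)"
      using not_same_edge[OF e(1) f(1) \<open>e \<noteq> f\<close> ij(1,2)] .
    ultimately have "g (i, j) (k, l) = 0"
      using gram_relation[OF cells] by simp
    with ij show ?thesis by blast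
  next
    case False
    then obtain a' b' where ab': "a' \<in> e" "b' \<in> f" "fst a' = fst b' \<or> snd a' = snd b'"
      unfolding vertex_disjoint_def row_set_def col_set_def by blast
    have "g a' b' = 0"
      using gram_same_line[OF edge_cells[OF e(1) ab'(1)] edge_cells[OF f(1) ab'(2)] ab'(3)]
        not_same_edge[OF e(1) f(1) \<open>e \<noteq> f\<close> ab'(1,2)] by simp
    with ab' show ?thesis by blast
  qed
  then obtain a' b' where *: "a' \<in> e" "b' \<in> f" "g a' b' = 0" by blast
  have "g a b = g a' b'"
  proof (rule gram_cong)
    show "v p a = v p a'" if "p \<in> I" for p
      using e(2)[unfolded coherent_def] ab(1) *(1) that by blast
    show "v p b = v p b'" if "p \<in> I" for p
      using f(2)[unfolded coherent_def] ab(2) *(2) that by blast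
  qed
  with * show ?thesis by simp
qed

lemma degenerate_coherent:
  assumes "e \<in> E2" "\<not> nondegenerate e"
  shows "coherent e"
proof -
  obtain i j k l where e: "e = {(i, j), (k, l)}" "(i, j) \<in> cells m n" "(k, l) \<in> cells m n"
    using E2_doubletonE[OF assms(1)] .
  then have "i = k \<or> j = l"
    using assms(2) unfolding nondegenerate_def by blast
  moreover have "same_edge (i, j) (k, l)"
    unfolding same_edge_def using E2_E[OF assms(1)] e by blast
  ultimately have "g (i, j) (k, l) = 1"
    using gram_same_line[OF e(2,3)] by simp
  with e show ?thesis
    using coherentI_gram by simp
qed

lemma E2_coherent: "e \<in> E2 \<Longrightarrow> coherent e"
proof (induction e rule: wf_induct_rule[OF wf_dependency[OF aug W2]])
  case (1 e)
  show ?case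
  proof (cases "nondegenerate e")
    case False
    with 1 show ?thesis by (simp add: degenerate_coherent)
  next
    case True
    then obtain i j k l where e: "e = {(i, j), (k, l)}" "i \<noteq> k" "j \<noteq> l"
      unfolding nondegenerate_def by blast
    have cells: "(i, j) \<in> cells m n" "(k, l) \<in> cells m n"
      using edge_cells[OF E2_E[OF 1(2)]] e by auto
    then have cells': "(i, l) \<in> cells m n" "(k, j) \<in> cells m n"
      by (auto simp: cells_def)
    have opp: "opposite_cells e = {(i, l), (k, j)}"
      unfolding e(1) by (rule opposite_cells_doubleton[OF e(2,3)])
    have same: "same_edge (i, j) (k, l)"
      unfolding same_edge_def using E2_E[OF 1(2)] e by blast
    have "g (i, j) (k, l) = 1"
    proof (cases "same_edge (i, l) (k, j)")
      case True
      \<comment> \<open>The complementary case: two inner products, each at most 1, have sum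
        2.\<close>
      then have "g (i, j) (k, l) + g (i, l) (k, j) = 2"
        using gram_relation[OF cells] same by simp
      then show ?thesis
        using gram_le_1[OF cells] gram_le_1[OF cells'] by linarith
    next
      case False
      \<comment> \<open>Now the right-hand side of \<open>gram_relation\<close> is 1, so
        orthogonality of the opposite cells suffices.\<close>
      have "g (i, l) (k, j) = 0"
      proof (cases "(i, l) \<in> Occ \<and> (k, j) \<in> Occ")
        case False
        then show ?thesis
          using gram_unoccupied cells' by blast
      next
        case True
        then obtain f h where f: "f \<in> E" "(i, l) \<in> f" and h: "h \<in> E" "(k, j) \<in> h"
          by (auto simp: occupied_eq_Union_edges)
        have fh: "f \<noteq> h"
          using False f h unfolding same_edge_def by blast
        \<comment> \<open>A complement would be one edge through both opposite cells, contrary to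
          the case. Hence the arcs leaving \<open>e\<close> belong to the well-founded
          relation.\<close>
        have no_comp: "\<not> has_complement E2 e"
        proof
          assume "has_complement E2 e"
          then obtain e' where "e' \<in> E2" "complementary e e'"
            by (auto simp: has_complement_def)
          then have "(i, l) \<in> e'" "(k, j) \<in> e'"
            using e by (auto simp: complementary_def doubleton_eq_iff)
          with \<open>e' \<in> E2\<close> False show False
            using E2_E unfolding same_edge_def by blast
        qed
        \<comment> \<open>An edge through an opposite cell is either a nondegenerate 2-edge reached
          by an arc from \<open>e\<close>, where the induction hypothesis applies, or a degenerate
          2-edge or single cell.\<close>
        have coh: "coherent f'" if f': "f' \<in> E" "c \<in> f'" "c \<in> {(i, l), (k, j)}" for f' c
        proof (cases "f' \<in> E2 \<and> nondegenerate f'")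
          case True
          have "f' \<noteq> e"
            using f' e by auto
          with True 1(2) \<open>nondegenerate e\<close> opp f' \<open>(i, l) \<in> Occ \<and> (k, j) \<in> Occ\<close>
          have "(e, f') \<in> parcs (dependency_graph E1 E2)"
            by (auto simp: dependency_graph_def)
          with no_comp True 1(1)[of f'] show ?thesis by simp
        next
          case False
          then show ?thesis
            using degenerate_coherent f' by (auto simp: edges_def coherent_def)
        qed
        \<comment> \<open>(W3) is silent on two 1-edges; (W2') rules them out here.\<close>
        have "f \<in> E2 \<or> h \<in> E2"
        proof (rule ccontr)
          assume "\<not> (f \<in> E2 \<or> h \<in> E2)"
          with f h have "opposite_cells e \<subseteq> E1"
            unfolding opp by (auto simp: edges_def)
          with W2' 1(2) \<open>nondegenerate e\<close> show False
            by (auto simp: cond_W2'_def)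
        qed
        then show ?thesis
          using coherent_orthogonal[of f h "(i, l)" "(k, j)"] coh f h fh by blast
      qed
      then show ?thesis
        using gram_relation[OF cells] same False by simp
    qed
    then show ?thesis
      using coherentI_gram[OF cells] e by simp
  qed
qed

section \<open>Orthogonality of distinct edges\<close>

lemma edge_coherent: "e \<in> E \<Longrightarrow> coherent e"
  using E2_coherent by (auto simp: edges_def coherent_def)

text \<open>(W3) says nothing about two 1-edges. Off a common line, orthogonality is transferred
  from the other diagonal of their rectangle, where coherence of all edges is available.\<close>

lemma E1_orthogonal:
  assumes "a \<in> E1" "b \<in> E1" "a \<noteq> b"
  shows "g a b = 0"
proof -
  have E: "{a} \<in> E" "{b} \<in> E"
    using assms unfolding edges_def by blast+
  have ns: "\<not> same_edge a b"
    using not_same_edge[OF E] assms by simp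
  obtain i j k l where ij: "a = (i, j)" "b = (k, l)"
    by (metis surj_pair)
  have cells: "(i, j) \<in> cells m n" "(k, l) \<in> cells m n"
    using edge_cells E ij by blast+
  show ?thesis
  proof (cases "i = k \<or> j = l")
    case True
    then show ?thesis
      using gram_same_line[OF cells] ns ij by simp
  next
    case False
    from cells have cells': "(i, l) \<in> cells m n" "(k, j) \<in> cells m n"
      by (auto simp: cells_def)
    \<comment> \<open>An edge through both other corners would be a 2-edge whose opposite cells are
      the two 1-edges, against (W2').\<close>
    have ns': "\<not> same_edge (i, l) (k, j)"
    proof
      assume "same_edge (i, l) (k, j)"
      then obtain e where e: "e \<in> E" "(i, l) \<in> e" "(k, j) \<in> e"
        by (auto simp: same_edge_def)
      with False have "e \<in> E2"
        by (auto simp: edges_def)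
      moreover from this e False have "e = {(i, l), (k, j)}"
        by (elim E2_doubletonE) auto
      moreover from this False have "nondegenerate e"
        unfolding nondegenerate_def by blast
      ultimately show False
        using W2' assms ij False opposite_cells_doubleton[of i k l j] by (auto simp: cond_W2'_def)
    qed
    have "g (i, l) (k, j) = 0"
    proof (cases "(i, l) \<in> Occ \<and> (k, j) \<in> Occ")
      case False
      then show ?thesis
        using gram_unoccupied cells' by blast
    next
      case True
      then obtain f h where f: "f \<in> E" "(i, l) \<in> f" and h: "h \<in> E" "(k, j) \<in> h"
        by (auto simp: occupied_eq_Union_edges)
      have "f \<noteq> h"
        using ns' f h unfolding same_edge_def by blast
      \<comment> \<open>Otherwise all four corners are 1-edges and form a 4-cycle, against
        (W1).\<close>
      moreover have "f \<in> E2 \<or> h \<in> E2"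
        using W1 assms ij False f h unfolding C4_free_def by (auto simp: edges_def)
      ultimately show ?thesis
        using coherent_orthogonal f h edge_coherent by blast
    qed
    then show ?thesis
      using gram_relation[OF cells] ns ns' ij by simp
  qed
qed

lemma edges_orthogonal:
  assumes "e \<in> E" "f \<in> E" "e \<noteq> f" "a \<in> e" "b \<in> f"
  shows "g a b = 0"
proof (cases "e \<in> E2 \<or> f \<in> E2")
  case True
  then show ?thesis
    using coherent_orthogonal assms edge_coherent by blast
next
  case False
  then have "a \<in> E1" "b \<in> E1" "a \<noteq> b"
    using assms by (auto simp: edges_def)
  then show ?thesis by (rule E1_orthogonal)
qed

lemma card_edges_le: "card E \<le> card I"
proof (rule card_orthonormal_le)
  show "finite E"
    using augmented_graph_finite(3)[OF aug] .
  \<comment> \<open>Any representative cell will do: it is occupied, so its vector has norm 1, and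
    cells of different edges are orthogonal.\<close>
  define c where "c e = (SOME a. a \<in> e)" for e :: "cell set"
  have c: "c e \<in> e" if "e \<in> E" for e
    unfolding c_def using edges_in_cells(2)[OF aug that] by (simp add: some_in_eq)
  show "(\<Sum>p\<in>I. v p (c e) * v p (c f)) = of_bool (e = f)" if ef: "e \<in> E" "f \<in> E" for e f
  proof (cases "e = f")
    case True
    moreover have "c e \<in> Occ"
      using c ef by (auto simp: occupied_eq_Union_edges)
    ultimately show ?thesis
      using gram_self[of "c e"] edge_cells[OF ef(1) c[OF ef(1)]] by (simp add: gram_def)
  next
    case False
    then show ?thesis
      using edges_orthogonal[OF ef False c c] ef by (simp add: gram_def)
  qed
qed (rule finI)

end

section \<open>The lower bound for BSR\<close>

lemma SOS_rank_edge_form: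
  assumes "weakly_admissible m n E1 E2"
  shows "card E1 + card E2 \<le> SOS_rank m n (edge_form m n E1 E2)"
proof -
  have aug: "augmented_graph m n E1 E2"
    using assms by (simp add: weakly_admissible_def)
  let ?r = "SOS_rank m n (edge_form m n E1 E2)"
  have "sum_of_squares m n ?r (edge_form m n E1 E2)"
    unfolding SOS_rank_def
    by (rule LeastI[where P = "\<lambda>r. sum_of_squares m n r (edge_form m n E1 E2)"])
      (rule sum_of_squares_edge_form[OF aug])
  then obtain v where "\<And>x y. edge_form m n E1 E2 x y = (\<Sum>p\<in>{1..?r}. (bilin m n (v p) x y)\<^sup>2)"
    unfolding sum_of_squares_iff by blast
  \<comment> \<open>The locale is instantiated with a shortest representation, so its bound on the
    number of squares applies to the rank itself.\<close>
  then interpret edge_form_representation m n E1 E2 "{1..?r}" v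
    using assms by unfold_locales auto
  show ?thesis
    using card_edges_le card_edges[OF aug] by simp
qed

lemma weakly_admissible_le_BSR:
  assumes "weakly_admissible m n E1 E2"
  shows "card E1 + card E2 \<le> BSR m n"
proof -
  have "is_SOS m n (edge_form m n E1 E2)"
    using assms sum_of_squares_edge_form unfolding is_SOS_def weakly_admissible_def by blast
  then show ?thesis
    using SOS_rank_edge_form[OF assms] SOS_rank_le_BSR is_SOS_imp_biquadratic_form le_trans
    by blast
qed

section \<open>Comparing the Zarankiewicz numbers\<close>

lemma no_arcs_imp_cond_W2:
  assumes "parcs (dependency_graph E1 E2) = {}"
  shows "cond_W2 E1 E2"
  using assms by (auto simp: cond_W2_def pre_digraph.cycle_def pre_digraph.awalk_def)

text \<open>Any cell of the other edge serves as \<open>(k, l)\<close>: it is occupied, and the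
  remaining four cells of Condition 3 are opposite cells of the pair. Degenerate 2-edges are
  covered, since \<open>i = p\<close> or \<open>j = q\<close> is allowed there.\<close>

lemma condition3_imp_cond_W3:
  assumes aug: "augmented_graph m n E1 E2" and C3: "condition3 E1 E2"
  shows "cond_W3 E1 E2"
proof -
  have *: "\<exists>c\<in>pair_opposite_cells e f. c \<notin> occupied E1 E2"
    if e: "e \<in> E2" and f: "f \<in> edges E1 E2" and vd: "vertex_disjoint e f" for e f
  proof (rule ccontr)
    assume "\<not> ?thesis"
    then have occ: "pair_opposite_cells e f \<subseteq> occupied E1 E2" by blast
    have "\<exists>c d. e = {c, d}"
      using e aug unfolding augmented_graph_def by blast
    then obtain i j p q where ij: "e = {(i, j), (p, q)}"
      by (metis surj_pair)
    obtain k l where kl: "(k, l) \<in> f"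
      using edges_in_cells(2)[OF aug f] by auto
    then have "k \<in> row_set f" "l \<in> col_set f"
      by (force simp: row_set_def col_set_def)+
    moreover have "row_set e = {i, p}" "col_set e = {j, q}"
      by (auto simp: ij row_set_def col_set_def)
    ultimately have "k \<notin> {i, p}" "l \<notin> {j, q}" "{(k, j), (k, q), (i, l), (p, l)} \<subseteq> pair_opposite_cells e f"
      using vd by (auto simp: vertex_disjoint_def pair_opposite_cells_def)
    moreover have "(k, l) \<in> occupied E1 E2"
      unfolding occupied_eq_Union_edges using kl f by (rule UnionI[rotated])
    ultimately have "{(i, j), (p, q)} \<in> E2 \<and> k \<notin> {i, p} \<and> l \<notin> {j, q} \<and>
        {(k, l), (k, j), (k, q), (i, l), (p, l)} \<subseteq> occupied E1 E2"
      using e subsetD[OF occ] unfolding ij by simp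
    then show False
      using C3 unfolding condition3_def by metis
  qed
  \<comment> \<open>(W3) permits the 2-edge in either position of the pair.\<close>
  moreover have "vertex_disjoint f e = vertex_disjoint e f"
    "pair_opposite_cells f e = pair_opposite_cells e f" for e f
    by (auto simp: vertex_disjoint_def pair_opposite_cells_def)
  ultimately show ?thesis
    unfolding cond_W3_def by metis
qed

lemma conditions_imp_weakly_admissible:
  assumes "augmented_graph m n E1 E2" "cond_S E1 E2" "cond_W1 E1" "condition2 E1 E2" "condition3 E1 E2"
  shows "weakly_admissible m n E1 E2"
proof -
  have "parcs (dependency_graph E1 E2) = {}"
    using assms(4) by (auto simp: condition2_def dependency_graph_def)
  moreover have "cond_W2' E1 E2"
    using assms(4) by (auto simp: condition2_def cond_W2'_def occupied_def)
  ultimately show ?thesis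
    using assms no_arcs_imp_cond_W2 condition3_imp_cond_W3 unfolding weakly_admissible_def by blast
qed

lemma zarankiewicz_attained:
  obtains E where "E \<subseteq> cells m n" "C4_free E" "card E = zarankiewicz m n"
proof -
  let ?Z = "{card E | E. E \<subseteq> cells m n \<and> C4_free E}"
  have "?Z \<subseteq> card ` Pow (cells m n)"
    by auto
  then have "finite ?Z"
    by (rule finite_subset) simp
  moreover have "card {} \<in> ?Z"
    by (intro CollectI exI[of _ "{}"]) (simp add: C4_free_def)
  ultimately have "Max ?Z \<in> ?Z"
    by (intro Max_in) auto
  then show ?thesis
    using that unfolding zarankiewicz_def by auto
qed

text \<open>Gives the finiteness under which inclusions of sets yield inequalities of their
  \<open>Max\<close>.\<close>

lemma finite_card_augmented_graphs:
  assumes "\<And>E1 E2. Q E1 E2 \<Longrightarrow> augmented_graph m n E1 E2"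
  shows "finite {card E1 + card E2 | E1 E2. Q E1 E2}"
proof -
  have "{card E1 + card E2 | E1 E2. Q E1 E2} \<subseteq>
      (\<lambda>(E1, E2). card E1 + card E2) ` (Pow (cells m n) \<times> Pow (Pow (cells m n)))"
    using assms by (fastforce simp: augmented_graph_def)
  then show ?thesis
    by (rule finite_subset) simp
qed

theorem theorem10:
  fixes m n :: nat
  assumes "m \<ge> 2" and "n \<ge> 2"
  shows "BSR m n \<ge> z_wA m n \<and> z_wA m n \<ge> z_wL m n \<and> z_wL m n \<ge> z_L m n \<and> z_L m n \<ge> zarankiewicz m n"
proof -
  let ?A = "{card E1 + card E2 | E1 E2. weakly_admissible m n E1 E2}"
  let ?wL = "{card E1 + card E2 | E1 E2. weakly_admissible m n E1 E2 \<and> card E1 = zarankiewicz m n}"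
  let ?L = "{card E1 + card E2 | E1 E2. augmented_graph m n E1 E2 \<and> card E1 = zarankiewicz m n \<and>
     cond_S E1 E2 \<and> cond_W1 E1 \<and> condition2 E1 E2 \<and> condition3 E1 E2}"
  obtain E where E: "E \<subseteq> cells m n" "C4_free E" "card E = zarankiewicz m n"
    by (rule zarankiewicz_attained)
  \<comment> \<open>An extremal 4-cycle-free graph without 2-edges meets the conditions on 2-edges
    vacuously. It yields the last inequality and makes all three sets nonempty.\<close>
  have zL: "zarankiewicz m n \<in> ?L"
    using E by (intro CollectI exI[of _ E] exI[of _ "{}"])
      (simp add: augmented_graph_def cond_S_def cond_W1_def condition2_def condition3_def)
  have L_wL: "?L \<subseteq> ?wL"
    by (intro Collect_mono ex_mono impI) (simp add: conditions_imp_weakly_admissible)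
  have wL_A: "?wL \<subseteq> ?A"
    by (intro Collect_mono ex_mono impI) simp
  have A: "finite ?A"
    by (rule finite_card_augmented_graphs[where m = m and n = n]) (simp add: weakly_admissible_def)
  have wL: "finite ?wL"
    using wL_A A by (rule finite_subset)
  have L: "finite ?L"
    using L_wL wL by (rule finite_subset)
  have ne: "?L \<noteq> {}" "?wL \<noteq> {}" "?A \<noteq> {}"
    using zL L_wL wL_A by blast+
  have "\<forall>s\<in>?A. s \<le> BSR m n"
    using weakly_admissible_le_BSR by blast
  then have "Max ?A \<le> BSR m n"
    using Max_le_iff[OF A ne(3)] by simp
  moreover have "Max ?wL \<le> Max ?A"
    using wL_A ne(2) A by (rule Max_mono)
  moreover have "Max ?L \<le> Max ?wL"
    using L_wL ne(1) wL by (rule Max_mono)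
  moreover have "zarankiewicz m n \<le> Max ?L"
    using L zL by (rule Max_ge)
  ultimately show ?thesis
    unfolding z_wA_def z_wL_def z_L_def by blast
qed

end
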